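(* For each node $k\in\mathcal{N}$ let an arbitrary set of information neighbors $\overline{\mathcal{N}}_{k\leftarrow}'\subseteq\overline{\mathcal{N}}_{k\leftarrow}$, $\overline{\mathcal{N}}_{k\leftarrow}'\neq\emptyset$, be given. Suppose that $\beta^{o}$ is the solution of the semi-definite program $$\beta^{o}=\arg\min_{\beta}\ \beta\quad\text{s.t.}\quad \begin{bmatrix}\beta(\mathcal{M}\mathcal{S}\mathcal{M})^{-1}+\tilde Q & \tilde Q(\mathbf{1}_N\otimes I_M)\\ (\mathbf{1}_N^T\otimes I_M)\tilde Q & (\mathbf{1}_N^T\otimes I_M)[\tilde Q-I_{NM}](\mathbf{1}_N\otimes I_M)\end{bmatrix}\succeq 0,$$ where $\tilde Q=(I_{NM}-\mathcal{M}\mathcal{R})^{-2}$, and let $\alpha^{o}=(\beta^{o}+1)^{-1}$. Then the combination weights $A=(a_{lk})\in\mathbb{R}^{N\times N}$ that solve the optimization problem $$\min_{A}\ \alpha^{o}\,\mathrm{Tr}(\mathcal{Y})+(1-\alpha^{o})\,\mathrm{Tr}(\mathcal{B}\mathcal{B}^{*})$$ $$\text{s.t. } a_{lk}\ge 0\ \text{ for all } l,k\in\mathcal{N},\quad A^{T}\mathbf{1}_N=\mathbf{1}_N,\quad a_{lk}=0\ \text{ if } l\notin\overline{\mathcal{N}}_{k\leftarrow}',$$ are given by $$a_{lk}=\begin{cases}\dfrac{\gamma_l^{-2}}{\sum_{j\in\overline{\mathcal{N}}_{k\leftarrow}'}\gamma_j^{-2}}, & \text{if } l\in\overline{\mathcal{N}}_{k\leftarrow}',\\[2mm]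 0, & \text{otherwise,}\end{cases}$$ where the composite variance $\gamma_l^2$ is defined by $$\gamma_l^2=\alpha^{o}\mu_l^2\,\sigma_{v,l}^2\,\mathrm{Tr}(R_{u,l})+(1-\alpha^{o})\,\mathrm{Tr}\big((I_M-\mu_l R_{u,l})^2\big).$$
   Context: A network is a directed graph with node set $\mathcal{N}=\{1,\dots,N\}$. The multi-hop neighborhood $\overline{\mathcal{N}}_{k\leftarrow}$ of node $k$ consists of $k$ itself and all nodes $l$ from which there is a directed path to $k$. For each node $k$: $\mu_k>0$ is a step size, $\sigma_{v,k}^2>0$ is a noise variance, and $R_{u,k}$ is an $M\times M$ Hermitian positive definite covariance matrix. $I_n$ is the $n\times n$ identity matrix, $\mathbf{1}_N$ is the all-ones column vector of length $N$, $\otimes$ is the Kronecker product, $X^{*}$ is the conjugate transpose, and $X\succeq0$ means $X$ is positive semi-definite. Define the $NM\times NM$ matrices $$\mathcal{M}=\mathrm{diag}\{\mu_1I_M,\dots,\mu_NI_M\},\quad \mathcal{R}=\mathrm{diag}\{R_{u,1},\dots,R_{u,N}\},\quad \mathcal{S}=\mathrm{diag}\{\sigma_{v,1}^2R_{u,1},\dots,\sigma_{v,N}^2R_{u,N}\}$$ (block diagonal), and, for a real $N\times N$ matrix $A=(a_{lk})$ (with $l$ the row index and $k$ the column index), $$\mathcal{A}=A\otimes I_M,\quad \mathcal{B}=\mathcal{A}^T(I_{NM}-\mathcal{M}\mathcal{R}),\quad \mathcal{Y}=\mathcal{A}^T\mathcal{M}\mathcal{S}\mathcal{M}\mathcal{A}.$$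 It is assumed that $I_{NM}-\mathcal{M}\mathcal{R}$ is invertible, so that $\tilde Q=(I_{NM}-\mathcal{M}\mathcal{R})^{-2}$ is well defined and positive definite. *)

theory Defs
  imports "HOL-Analysis.Analysis"
begin

text \<open>
  A matrix of type \<open>'a ^ 'c ^ 'r\<close> has its rows indexed by \<open>'r\<close> and its columns by \<open>'c\<close>.
  Nodes are indexed by a finite type \<open>'n\<close> and the entries of the covariance matrices by a finite
  type \<open>'m\<close>, so that \<open>'n \<times> 'm\<close> indexes the rows and columns of an \<open>NM \<times> NM\<close> matrix
  that consists of \<open>M \<times> M\<close> blocks, and the sum type indexes two-by-two block matrices.
\<close>

definition conj_transpose :: "complex ^ 'c ^ 'r \<Rightarrow> complex ^ 'r ^ 'c" where
  "conj_transpose X = map_matrix cnj (transpose X)"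

definition hermitian :: "complex ^ 'k ^ 'k \<Rightarrow> bool" where
  "hermitian X \<longleftrightarrow> conj_transpose X = X"

definition quad_form :: "complex ^ 'k ^ 'k \<Rightarrow> complex ^ 'k \<Rightarrow> complex" where
  "quad_form X z = (\<Sum>i\<in>UNIV. cnj (z $ i) * (X *v z) $ i)"

text \<open>The quadratic form of a Hermitian matrix is real-valued, so \<^const>\<open>Re\<close> loses nothing.\<close>

definition pos_def :: "complex ^ 'k ^ 'k \<Rightarrow> bool" where
  "pos_def X \<longleftrightarrow> hermitian X \<and> (\<forall>z. z \<noteq> 0 \<longrightarrow> 0 < Re (quad_form X z))"

definition pos_semidef :: "complex ^ 'k ^ 'k \<Rightarrow> bool" where
  "pos_semidef X \<longleftrightarrow> hermitian X \<and> (\<forall>z. 0 \<le> Re (quad_form X z))"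

text \<open>Similarly for traces.\<close>

lemma hermitian_trace_real:
  assumes "hermitian X"
  shows "complex_of_real (Re (trace X)) = trace X"
proof -
  have "cnj (X $ i $ i) = X $ i $ i" for i
    using arg_cong[OF assms[unfolded hermitian_def], of "\<lambda>Y. Y $ i $ i"]
    by (simp add: conj_transpose_def map_matrix_def transpose_def)
  then have "cnj (trace X) = trace X"
    by (simp add: trace_def)
  then show ?thesis
    by (simp add: complex_eq_iff)
qed

definition kron :: "'a::times ^ 'c ^ 'r \<Rightarrow> 'a ^ 'd ^ 's \<Rightarrow> 'a ^ ('c \<times> 'd) ^ ('r \<times> 's)"
    (infixl "\<otimes>\<^sub>K" 75) where
  "X \<otimes>\<^sub>K Y = (\<chi> i j. X $ fst i $ fst j * Y $ snd i $ snd j)"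

definition block_diag :: "('n \<Rightarrow> 'a::zero ^ 'm ^ 'm) \<Rightarrow> 'a ^ ('n::finite \<times> 'm::finite) ^ ('n \<times> 'm)" where
  "block_diag X = (\<chi> i j. if fst i = fst j then X (fst i) $ snd i $ snd j else 0)"

definition block_matrix ::
  "'a ^ 'c ^ 'r \<Rightarrow> 'a ^ 'd ^ 'r \<Rightarrow> 'a ^ 'c ^ 's \<Rightarrow> 'a ^ 'd ^ 's \<Rightarrow> 'a ^ ('c + 'd) ^ ('r + 's)" where
  "block_matrix P Q U V =
     (\<chi> i j. case i of
        Inl r \<Rightarrow> (case j of Inl c \<Rightarrow> P $ r $ c | Inr d \<Rightarrow> Q $ r $ d)
      | Inr s \<Rightarrow> (case j of Inl c \<Rightarrow> U $ s $ c | Inr d \<Rightarrow> V $ s $ d))"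

text \<open>Here \<open>(l, k) \<in> E\<close> is an edge from \<open>l\<close> to \<open>k\<close>.\<close>

definition multihop_nbhd :: "('n \<times> 'n) set \<Rightarrow> 'n \<Rightarrow> 'n set" where
  "multihop_nbhd E k = insert k {l. (l, k) \<in> E\<^sup>+}"

text \<open>Note that \<open>mat c\<close> is the scalar matrix \<open>c I\<close>.\<close>

definition step_matrix :: "('n \<Rightarrow> real) \<Rightarrow> complex ^ ('n::finite \<times> 'm::finite) ^ ('n \<times> 'm)" where
  "step_matrix \<mu> = block_diag (\<lambda>k. mat (complex_of_real (\<mu> k)))"

definition cov_matrix :: "('n \<Rightarrow> complex ^ 'm ^ 'm) \<Rightarrow> complex ^ ('n::finite \<times> 'm::finite) ^ ('n \<times> 'm)" where
  "cov_matrix R = block_diag R"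

definition noise_matrix ::
  "('n \<Rightarrow> real) \<Rightarrow> ('n \<Rightarrow> complex ^ 'm ^ 'm) \<Rightarrow> complex ^ ('n::finite \<times> 'm::finite) ^ ('n \<times> 'm)" where
  "noise_matrix \<sigma> R = block_diag (\<lambda>k. (\<sigma> k)\<^sup>2 *\<^sub>R R k)"

definition comb_matrix :: "real ^ 'n ^ 'n \<Rightarrow> complex ^ ('n::finite \<times> 'm::finite) ^ ('n \<times> 'm)" where
  "comb_matrix A = map_matrix complex_of_real A \<otimes>\<^sub>K mat 1"

definition B_matrix ::
  "('n \<Rightarrow> real) \<Rightarrow> ('n \<Rightarrow> complex ^ 'm ^ 'm) \<Rightarrow> real ^ 'n ^ 'n
    \<Rightarrow> complex ^ ('n::finite \<times> 'm::finite) ^ ('n \<times> 'm)" where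
  "B_matrix \<mu> R A = transpose (comb_matrix A) ** (mat 1 - step_matrix \<mu> ** cov_matrix R)"

definition Y_matrix ::
  "('n \<Rightarrow> real) \<Rightarrow> ('n \<Rightarrow> real) \<Rightarrow> ('n \<Rightarrow> complex ^ 'm ^ 'm) \<Rightarrow> real ^ 'n ^ 'n
    \<Rightarrow> complex ^ ('n::finite \<times> 'm::finite) ^ ('n \<times> 'm)" where
  "Y_matrix \<mu> \<sigma> R A =
     transpose (comb_matrix A) ** step_matrix \<mu> ** noise_matrix \<sigma> R ** step_matrix \<mu>
       ** comb_matrix A"

definition Q_matrix ::
  "('n \<Rightarrow> real) \<Rightarrow> ('n \<Rightarrow> complex ^ 'm ^ 'm) \<Rightarrow> complex ^ ('n::finite \<times> 'm::finite) ^ ('n \<times> 'm)" where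
  "Q_matrix \<mu> R =
     (let P = matrix_inv (mat 1 - step_matrix \<mu> ** cov_matrix R) in P ** P)"

text \<open>
  In \<open>ones_col\<close>, the vector \<open>1 :: complex ^ 'n\<close> is the all-ones vector and
  \<^const>\<open>columnvector\<close> makes it a matrix whose columns are indexed by a one-element type.
\<close>

definition ones_col :: "complex ^ (1 \<times> 'm::finite) ^ ('n::finite \<times> 'm)" where
  "ones_col = (columnvector (1 :: complex ^ 'n) :: complex ^ 1 ^ 'n) \<otimes>\<^sub>K mat 1"

definition sdp_matrix ::
  "('n \<Rightarrow> real) \<Rightarrow> ('n \<Rightarrow> real) \<Rightarrow> ('n \<Rightarrow> complex ^ 'm ^ 'm) \<Rightarrow> real
    \<Rightarrow> complex ^ (('n::finite \<times> 'm::finite) + (1 \<times> 'm)) ^ (('n \<times> 'm) + (1 \<times> 'm))" where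
  "sdp_matrix \<mu> \<sigma> R \<beta> =
     (let Q = Q_matrix \<mu> R in
      block_matrix
        (\<beta> *\<^sub>R matrix_inv (step_matrix \<mu> ** noise_matrix \<sigma> R ** step_matrix \<mu>) + Q)
        (Q ** ones_col)
        (transpose ones_col ** Q)
        (transpose ones_col ** (Q - mat 1) ** ones_col))"

definition weight_cost ::
  "('n \<Rightarrow> real) \<Rightarrow> ('n \<Rightarrow> real) \<Rightarrow> ('n \<Rightarrow> complex ^ 'm ^ 'm) \<Rightarrow> real \<Rightarrow> real ^ 'n ^ 'n \<Rightarrow> real" where
  "weight_cost \<mu> \<sigma> R \<alpha> A =
     \<alpha> * Re (trace (Y_matrix \<mu> \<sigma> R A))
     + (1 - \<alpha>) * Re (trace (B_matrix \<mu> R A ** conj_transpose (B_matrix \<mu> R A)))"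

text \<open>The entry \<open>A $ l $ k\<close> is the weight that node \<open>k\<close> gives to node \<open>l\<close>.\<close>

definition feasible_weights :: "('n \<Rightarrow> 'n set) \<Rightarrow> real ^ 'n ^ 'n \<Rightarrow> bool" where
  "feasible_weights Nb A \<longleftrightarrow>
     (\<forall>l k. 0 \<le> A $ l $ k) \<and> transpose A *v 1 = 1 \<and> (\<forall>l k. l \<notin> Nb k \<longrightarrow> A $ l $ k = 0)"

definition composite_variance ::
  "('n \<Rightarrow> real) \<Rightarrow> ('n \<Rightarrow> real) \<Rightarrow> ('n \<Rightarrow> complex ^ 'm ^ 'm) \<Rightarrow> real \<Rightarrow> 'n \<Rightarrow> real" where
  "composite_variance \<mu> \<sigma> R \<alpha> l =
     \<alpha> * (\<mu> l)\<^sup>2 * (\<sigma> l)\<^sup>2 * Re (trace (R l))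
     + (1 - \<alpha>) * Re (trace ((mat 1 - \<mu> l *\<^sub>R R l) ** (mat 1 - \<mu> l *\<^sub>R R l)))"

end

theory Submission
  imports Defs
begin

text \<open>
  Testing the semi-definite constraint at the vector \<open>(-v, y)\<close>, where \<open>v = (1 \<otimes> I) y\<close>, makes
  all terms with \<open>Q\<close> cancel and leaves \<open>\<beta> v\<^sup>* (MSM)\<^sup>-\<^sup>1 v \<ge> v\<^sup>* v\<close>. Hence every feasible \<open>\<beta>\<close>
  is positive, \<open>\<alpha>\<^sub>o\<close> lies in \<open>(0, 1)\<close>, and the composite variances are positive. Since \<open>MSM\<close> and
  \<open>I - MR\<close> are block diagonal, the cost is the sum of \<open>a\<^bsub>lk\<^esub>\<^sup>2 \<gamma>\<^sub>l\<^sup>2\<close> over all \<open>l\<close> and \<open>k\<close>,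
  which is minimised column by column by completing the square.
\<close>

subsection \<open>Sesquilinear forms\<close>

definition cdot :: "complex ^ 'k \<Rightarrow> complex ^ 'k \<Rightarrow> complex" where
  "cdot x y = (\<Sum>i\<in>UNIV. cnj (x $ i) * y $ i)"

lemma quad_form_cdot: "quad_form X z = cdot z (X *v z)"
  by (simp add: quad_form_def cdot_def)

lemma cdot_add_right: "cdot x (y + z) = cdot x y + cdot x z"
  by (simp add: cdot_def algebra_simps sum.distrib)

lemma cdot_diff_right: "cdot x (y - z) = cdot x y - cdot x z"
  by (simp add: cdot_def algebra_simps sum_subtractf)

lemma cdot_minus_right: "cdot x (- y) = - cdot x y"
  by (simp add: cdot_def sum_negf)

lemma cdot_minus_left: "cdot (- x) y = - cdot x y"
  by (simp add: cdot_def sum_negf)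

lemma cdot_scaleR_right: "cdot x (c *\<^sub>R y) = c *\<^sub>R cdot x y"
  by (simp add: cdot_def scaleR_sum_right)

lemma cdot_commute: "cdot y x = cnj (cdot x y)"
  by (simp add: cdot_def mult.commute)

lemma cdot_conj_transpose: "cdot x (conj_transpose X *v y) = cdot (X *v x) y"
proof -
  have "cdot x (conj_transpose X *v y) = (\<Sum>i\<in>UNIV. \<Sum>j\<in>UNIV. cnj (x $ i) * (cnj (X $ j $ i) * y $ j))"
    by (simp add: cdot_def conj_transpose_def map_matrix_def transpose_def
        matrix_vector_mult_def sum_distrib_left)
  also have "\<dots> = (\<Sum>j\<in>UNIV. \<Sum>i\<in>UNIV. cnj (x $ i) * (cnj (X $ j $ i) * y $ j))"
    by (rule sum.swap)
  also have "\<dots> = cdot (X *v x) y"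
    by (simp add: cdot_def matrix_vector_mult_def sum_distrib_left sum_distrib_right mult_ac)
  finally show ?thesis .
qed

lemma scaleR_matrix_vector: "(c *\<^sub>R X) *v (x :: complex ^ 'c) = c *\<^sub>R (X *v x)"
  by (simp add: vec_eq_iff matrix_vector_mult_def scaleR_sum_right)

lemma matrix_vector_mult_uminus: "X *v (- x) = - (X *v (x :: complex ^ 'c))"
  by (simp add: vec_eq_iff matrix_vector_mult_def sum_negf)

lemma sum_UNIV_Plus:
  fixes f :: "'a::finite + 'b::finite \<Rightarrow> 'c::comm_monoid_add"
  shows "(\<Sum>s\<in>UNIV. f s) = (\<Sum>i\<in>UNIV. f (Inl i)) + (\<Sum>j\<in>UNIV. f (Inr j))"
  by (simp add: sum.Plus flip: UNIV_Plus_UNIV)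

lemma sum_UNIV_Times:
  fixes f :: "'a::finite \<times> 'b::finite \<Rightarrow> 'c::comm_monoid_add"
  shows "(\<Sum>s\<in>UNIV. f s) = (\<Sum>i\<in>UNIV. \<Sum>j\<in>UNIV. f (i, j))"
  by (simp add: sum.cartesian_product flip: UNIV_Times_UNIV)

text \<open>Used to test the semi-definite constraint: the case expression stacks \<open>x\<close>
  on \<open>y\<close>, and the form of the two-by-two block matrix splits into one term per
  block.\<close>

lemma quad_form_block_matrix:
  "quad_form (block_matrix P Q U V) (\<chi> s. case s of Inl i \<Rightarrow> x $ i | Inr j \<Rightarrow> y $ j) =
    cdot x (P *v x) + cdot x (Q *v y) + cdot y (U *v x) + cdot y (V *v y)"
  by (simp add: quad_form_def cdot_def block_matrix_def matrix_vector_mult_def sum_UNIV_Plus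
      distrib_left sum.distrib)

subsection \<open>Positive definite and block diagonal matrices\<close>

text \<open>A nonzero kernel vector would make the quadratic form vanish, so the kernel is trivial;
  for a square matrix a left inverse is an inverse.\<close>

lemma pos_def_invertible:
  assumes "pos_def X"
  shows "invertible X"
proof -
  have "z = 0" if "X *v z = 0" for z
  proof (rule ccontr)
    assume "z \<noteq> 0"
    then have "0 < Re (quad_form X z)"
      using assms by (simp add: pos_def_def)
    then show False
      using that by (simp add: quad_form_def)
  qed
  then obtain Y where "Y ** X = mat 1"
    using matrix_left_invertible_ker by metis
  then show ?thesis
    using invertible_left_inverse by blast
qed

text \<open>With \<open>z = X *v u\<close>, the form of the inverse at \<open>z\<close> is the
  conjugate of the form of \<open>X\<close> at \<open>u\<close>, so both have the same real
  part.\<close>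

lemma pos_def_quad_form_inv_nonneg:
  assumes "pos_def X"
  shows "0 \<le> Re (quad_form (matrix_inv X) z)"
proof -
  define u where "u = matrix_inv X *v z"
  have "X ** matrix_inv X = mat 1"
    using pos_def_invertible[OF assms] unfolding invertible_def matrix_inv_def
    by (rule someI_ex[THEN conjunct1])
  then have z: "z = X *v u"
    by (simp add: u_def matrix_vector_mul_assoc)
  have "quad_form (matrix_inv X) z = cnj (quad_form X u)"
    unfolding quad_form_cdot u_def[symmetric] by (subst z) (rule cdot_commute)
  moreover have "0 \<le> Re (quad_form X u)"
    using assms unfolding pos_def_def
    by (cases "u = 0") (auto simp: quad_form_def intro: less_imp_le)
  ultimately show ?thesis
    by simp
qed

text \<open>Pulls a condition on block indices out of the sum over inner indices, so that the sum
  over blocks collapses to a single block.\<close>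

lemma sum_if_const: "(\<Sum>b\<in>B. if P then f b else 0) = (if P then sum f B else 0)"
  by simp

lemma block_diag_mult: "block_diag X ** block_diag Y = block_diag (\<lambda>k. X k ** Y k)"
  by (simp add: vec_eq_iff block_diag_def matrix_matrix_mult_def sum_UNIV_Times
      if_distrib[of "\<lambda>x. x * _"] sum_if_const cong: if_cong)

lemma mat_block_diag: "mat c = block_diag (\<lambda>_. mat c)"
  by (auto simp: vec_eq_iff block_diag_def mat_def prod_eq_iff)

lemma block_diag_diff:
  fixes X :: "'n::finite \<Rightarrow> complex ^ 'm::finite ^ 'm"
  shows "block_diag X - block_diag Y = block_diag (\<lambda>k. X k - Y k)"
  by (simp add: vec_eq_iff block_diag_def)

lemma conj_transpose_block_diag:
  "conj_transpose (block_diag X) = block_diag (\<lambda>k. conj_transpose (X k))"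
  by (auto simp: vec_eq_iff block_diag_def conj_transpose_def map_matrix_def transpose_def)

lemma quad_form_block_diag:
  "quad_form (block_diag X) z = (\<Sum>k\<in>UNIV. quad_form (X k) (\<chi> i. z $ (k, i)))"
  by (simp add: quad_form_def matrix_vector_mult_def block_diag_def sum_UNIV_Times
      if_distrib[of "\<lambda>x. x * _"] sum_if_const cong: if_cong)

text \<open>The form is the sum of the forms of the blocks on the slices of \<open>z\<close>; a
  nonzero \<open>z\<close> has a nonzero slice, whose term is strictly positive.\<close>

lemma pos_def_block_diag:
  assumes "\<And>k. pos_def (X k)"
  shows "pos_def (block_diag X)"
proof -
  have "0 < Re (quad_form (block_diag X) z)" if "z \<noteq> 0" for z
  proof -
    have nonneg: "0 \<le> Re (quad_form (X k) u)" for k u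
      using assms[of k] unfolding pos_def_def
      by (cases "u = 0") (auto simp: quad_form_def intro: less_imp_le)
    obtain k i where "z $ (k, i) \<noteq> 0"
      using \<open>z \<noteq> 0\<close> by (auto simp: vec_eq_iff)
    then have "(\<chi> i. z $ (k, i)) \<noteq> 0"
      by (auto simp: vec_eq_iff)
    then have "0 < Re (quad_form (X k) (\<chi> i. z $ (k, i)))"
      using assms[of k] by (simp add: pos_def_def)
    then show ?thesis
      unfolding quad_form_block_diag Re_sum by (intro sum_pos2[of _ k]) (auto intro: nonneg)
  qed
  moreover have "hermitian (block_diag X)"
    using assms by (simp add: hermitian_def pos_def_def conj_transpose_block_diag)
  ultimately show ?thesis
    by (simp add: pos_def_def)
qed

lemma pos_def_scaleR:
  assumes "pos_def X" "0 < c"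
  shows "pos_def (c *\<^sub>R X)"
proof -
  have "conj_transpose (c *\<^sub>R X) = c *\<^sub>R conj_transpose X"
    by (simp add: vec_eq_iff conj_transpose_def map_matrix_def transpose_def)
  then show ?thesis
    using assms by (simp add: pos_def_def hermitian_def quad_form_cdot scaleR_matrix_vector
        cdot_scaleR_right)
qed

text \<open>Every diagonal entry is the value of the form at a standard basis vector.\<close>

lemma pos_def_trace_pos:
  assumes "pos_def X"
  shows "0 < Re (trace X)"
proof -
  have "0 < Re (X $ i $ i)" for i
  proof -
    have "quad_form X (axis i 1) = X $ i $ i"
      by (simp add: quad_form_def matrix_vector_mult_def axis_def
          if_distrib[of "\<lambda>x. _ * x"] if_distrib[of "\<lambda>x. x * _"] if_distrib[of cnj] cong: if_cong)
    moreover have "axis i (1 :: complex) \<noteq> 0"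
      by simp
    ultimately show ?thesis
      using assms by (metis pos_def_def)
  qed
  then show ?thesis
    by (simp add: trace_def sum_pos)
qed

text \<open>For Hermitian \<open>X\<close> this trace is the sum of the squared moduli of all
  entries.\<close>

lemma hermitian_trace_square_nonneg:
  assumes "hermitian X"
  shows "0 \<le> Re (trace (X ** X))"
proof -
  have entry: "X $ j $ i = cnj (X $ i $ j)" for i j
    using arg_cong[OF assms[unfolded hermitian_def], of "\<lambda>Y. Y $ j $ i"]
    by (simp add: conj_transpose_def map_matrix_def transpose_def)
  have "trace (X ** X) = (\<Sum>i\<in>UNIV. \<Sum>j\<in>UNIV. X $ i $ j * X $ j $ i)"
    by (simp add: trace_def matrix_matrix_mult_def)
  also have "\<dots> = (\<Sum>i\<in>UNIV. \<Sum>j\<in>UNIV. X $ i $ j * cnj (X $ i $ j))"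
    by (intro sum.cong refl arg_cong2[where f = times] entry)
  finally show ?thesis
    by (auto intro!: sum_nonneg)
qed

subsection \<open>The semi-definite constraint\<close>

text \<open>The outer blocks are scalar matrices, so they merge into one real factor. The result
  serves both the positivity of \<open>MSM\<close> and the trace of \<open>Y_matrix\<close>.\<close>

lemma scaled_noise_block_diag:
  "step_matrix \<mu> ** noise_matrix \<sigma> R ** step_matrix \<mu> =
    block_diag (\<lambda>k. ((\<mu> k)\<^sup>2 * (\<sigma> k)\<^sup>2) *\<^sub>R R k)"
proof -
  have "mat (complex_of_real c) ** X ** mat (complex_of_real c) = c\<^sup>2 *\<^sub>R X" for c and X :: "complex ^ 'b ^ 'b"
    by (simp add: vec_eq_iff matrix_matrix_mult_def mat_def if_distrib[of "\<lambda>x. x * _"]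
        if_distrib[of "\<lambda>x. _ * x"] power2_eq_square scaleR_conv_of_real[where 'a = complex] cong: if_cong)
  then show ?thesis
    by (simp add: step_matrix_def noise_matrix_def block_diag_mult)
qed

text \<open>The two all-ones vectors differ in length: M on the left, NM on the right.\<close>

lemma ones_col_mult_one: "(ones_col :: complex ^ (1 \<times> 'm::finite) ^ ('n::finite \<times> 'm)) *v 1 = 1"
  by (simp add: vec_eq_iff ones_col_def kron_def columnvector_def mat_def matrix_vector_mult_def
      sum_UNIV_Times)

lemma conj_transpose_ones_col: "conj_transpose ones_col = transpose ones_col"
  by (simp add: vec_eq_iff ones_col_def kron_def columnvector_def mat_def conj_transpose_def
      map_matrix_def transpose_def)

lemma sdp_feasible_pos:
  fixes R :: "'n::finite \<Rightarrow> complex ^ 'm::finite ^ 'm"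
  assumes "\<And>k. 0 < \<mu> k" "\<And>k. 0 < (\<sigma> k)\<^sup>2" "\<And>k. pos_def (R k)"
    and sdp: "pos_semidef (sdp_matrix \<mu> \<sigma> R \<beta>)"
  shows "0 < \<beta>"
proof -
  define W where "W = matrix_inv (step_matrix \<mu> ** noise_matrix \<sigma> R ** step_matrix \<mu>)"
  define Q where "Q = Q_matrix \<mu> R"
  define v where "v = (1 :: complex ^ ('n \<times> 'm))"
  have v: "ones_col *v 1 = v"
    unfolding v_def by (rule ones_col_mult_one)
  \<comment> \<open>The entries of \<open>ones_col\<close> are real, so its transpose is its
    adjoint.\<close>
  have adj: "cdot 1 (transpose ones_col *v u) = cdot v u" for u :: "complex ^ ('n \<times> 'm)"
    using cdot_conj_transpose[of 1 ones_col u] by (simp add: conj_transpose_ones_col v)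
  \<comment> \<open>The test vector with \<open>y = 1\<close>. The four blocks contribute
    \<open>cdot v (Q *v v)\<close> with signs +, -, -, +, and the identity subtracted in the last
    block leaves \<open>- cdot v v\<close>.\<close>
  have "quad_form (sdp_matrix \<mu> \<sigma> R \<beta>)
      (\<chi> s. case s of Inl i \<Rightarrow> (- v) $ i | Inr j \<Rightarrow> 1 $ j) = \<beta> *\<^sub>R quad_form W v - cdot v v"
    unfolding sdp_matrix_def Let_def quad_form_block_matrix W_def[symmetric] Q_def[symmetric]
      quad_form_cdot[of W]
    by (simp add: matrix_vector_mul_assoc[symmetric] v adj matrix_vector_mult_add_rdistrib
        matrix_vector_mult_diff_rdistrib matrix_vector_mult_uminus scaleR_matrix_vector
        cdot_minus_left cdot_minus_right cdot_add_right cdot_diff_right cdot_scaleR_right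
        del: transpose_matrix_vector)
  moreover have "0 \<le> Re (quad_form (sdp_matrix \<mu> \<sigma> R \<beta>)
      (\<chi> s. case s of Inl i \<Rightarrow> (- v) $ i | Inr j \<Rightarrow> 1 $ j))"
    using sdp unfolding pos_semidef_def by blast
  ultimately have "Re (cdot v v) \<le> \<beta> * Re (quad_form W v)"
    by simp
  moreover have "0 < Re (cdot v v)"
    by (simp add: cdot_def v_def)
  moreover have "0 \<le> Re (quad_form W v)"
    unfolding W_def scaled_noise_block_diag using assms(1-3)
    by (intro pos_def_quad_form_inv_nonneg pos_def_block_diag pos_def_scaleR)
      (auto simp: less_imp_neq[THEN not_sym])
  \<comment> \<open>If \<beta> were nonpositive, the upper bound on \<open>Re (cdot v v)\<close>
    would be nonpositive too.\<close>
  ultimately show ?thesis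
    using mult_nonpos_nonneg[of \<beta> "Re (quad_form W v)"] by linarith
qed

subsection \<open>The cost as a weighted sum of squares\<close>

text \<open>A combination matrix acts on blocks by scalars, so the diagonal block at
  \<open>k\<close> of the product is the sum of \<open>(A $ l $ k)\<^sup>2 *\<^sub>R D l\<close>
  over \<open>l\<close>.\<close>

lemma trace_comb_block_diag:
  "trace (transpose (comb_matrix A) ** block_diag D ** comb_matrix A) =
    (\<Sum>k\<in>UNIV. \<Sum>l\<in>UNIV. (A $ l $ k)\<^sup>2 *\<^sub>R trace (D l))"
proof -
  have comb: "comb_matrix A $ (l, j) $ (k, i) = (if j = i then complex_of_real (A $ l $ k) else 0)"
    for l k and i j :: 'b
    by (simp add: comb_matrix_def kron_def map_matrix_def mat_def)
  have "(transpose (comb_matrix A) ** block_diag D) $ (k, i) $ (l, j) =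
      complex_of_real (A $ l $ k) * D l $ i $ j" for k i l j
    by (simp add: matrix_matrix_mult_def block_diag_def transpose_def comb sum_UNIV_Times
        if_distrib[of "\<lambda>x. x * _"] if_distrib[of "\<lambda>x. _ * x"] sum_if_const cong: if_cong)
  then have "(transpose (comb_matrix A) ** block_diag D ** comb_matrix A) $ (k, i) $ (k, i) =
      (\<Sum>l\<in>UNIV. (A $ l $ k)\<^sup>2 *\<^sub>R D l $ i $ i)" for k i
    by (simp add: matrix_matrix_mult_def[of "transpose (comb_matrix A) ** block_diag D"]
        comb sum_UNIV_Times if_distrib[of "\<lambda>x. _ * x"] power2_eq_square
        scaleR_conv_of_real[where 'a = complex] mult_ac cong: if_cong)
  then have "trace (transpose (comb_matrix A) ** block_diag D ** comb_matrix A) =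
      (\<Sum>k\<in>UNIV. \<Sum>i\<in>UNIV. \<Sum>l\<in>UNIV. (A $ l $ k)\<^sup>2 *\<^sub>R D l $ i $ i)"
    by (simp add: trace_def sum_UNIV_Times)
  also have "\<dots> = (\<Sum>k\<in>UNIV. \<Sum>l\<in>UNIV. \<Sum>i\<in>UNIV. (A $ l $ k)\<^sup>2 *\<^sub>R D l $ i $ i)"
    by (intro sum.cong refl sum.swap)
  finally show ?thesis
    by (simp add: trace_def scaleR_sum_right)
qed

text \<open>The blocks \<open>P l\<close> of \<open>I - MR\<close> are Hermitian, so the second
  trace has the same shape as the first, with \<open>P l ** P l\<close> as the middle blocks;
  \<open>trace_comb_block_diag\<close> evaluates both.\<close>

lemma weight_cost_eq:
  assumes "\<And>k. pos_def (R k)"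
  shows "weight_cost \<mu> \<sigma> R \<alpha> A =
    (\<Sum>k\<in>UNIV. \<Sum>l\<in>UNIV. composite_variance \<mu> \<sigma> R \<alpha> l * (A $ l $ k)\<^sup>2)"
proof -
  define P where "P l = mat 1 - \<mu> l *\<^sub>R R l" for l
  have herm: "conj_transpose (R l) = R l" for l
    using assms by (simp add: pos_def_def hermitian_def)
  have mult: "mat (complex_of_real c) ** X = c *\<^sub>R X" for c and X :: "complex ^ 'b ^ 'b"
    by (simp add: vec_eq_iff matrix_matrix_mult_def mat_def if_distrib[of "\<lambda>x. x * _"]
        scaleR_conv_of_real[where 'a = complex] cong: if_cong)
  have P: "mat 1 - step_matrix \<mu> ** cov_matrix R = block_diag P"
    by (simp add: step_matrix_def cov_matrix_def block_diag_mult mult mat_block_diag[of 1]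
        block_diag_diff P_def[abs_def])
  have "conj_transpose (P l) = mat 1 - \<mu> l *\<^sub>R conj_transpose (R l)" for l
    by (simp add: P_def vec_eq_iff conj_transpose_def map_matrix_def transpose_def mat_def)
  then have P': "conj_transpose (P l) = P l" for l
    by (simp add: herm P_def)
  have mult': "conj_transpose (X ** Y) = conj_transpose Y ** conj_transpose X"
    for X Y :: "complex ^ 'c ^ 'c"
    by (simp add: conj_transpose_def map_matrix_def vec_eq_iff transpose_def
        matrix_matrix_mult_def mult.commute)
  have comb: "conj_transpose (transpose (comb_matrix A)) = comb_matrix A"
    by (simp add: conj_transpose_def map_matrix_def vec_eq_iff transpose_def
        comb_matrix_def kron_def mat_def)
  have B: "B_matrix \<mu> R A ** conj_transpose (B_matrix \<mu> R A) =
      transpose (comb_matrix A) ** block_diag (\<lambda>l. P l ** P l) ** comb_matrix A"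
    unfolding B_matrix_def P
    by (simp add: mult' comb conj_transpose_block_diag P' matrix_mul_assoc
        flip: block_diag_mult)
  have Y: "Y_matrix \<mu> \<sigma> R A = transpose (comb_matrix A)
      ** block_diag (\<lambda>k. ((\<mu> k)\<^sup>2 * (\<sigma> k)\<^sup>2) *\<^sub>R R k) ** comb_matrix A"
    unfolding Y_matrix_def scaled_noise_block_diag[symmetric] by (simp add: matrix_mul_assoc)
  have tr: "Re (trace (c *\<^sub>R X)) = c * Re (trace X)" for c and X :: "complex ^ 'b ^ 'b"
    by (simp add: trace_def sum_distrib_left)
  show ?thesis
    unfolding weight_cost_def B Y trace_comb_block_diag composite_variance_def
      P_def[symmetric]
    by (simp add: tr sum_distrib_left flip: sum.distrib) (simp add: algebra_simps)
qed

text \<open>The noise term is strictly positive because \<alpha> is; the other term is a nonnegative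
  multiple of the trace of a Hermitian square.\<close>

lemma composite_variance_pos:
  assumes "0 < \<mu> l" "0 < (\<sigma> l)\<^sup>2" "pos_def (R l)" "0 < \<alpha>" "\<alpha> \<le> 1"
  shows "0 < composite_variance \<mu> \<sigma> R \<alpha> l"
proof -
  have "conj_transpose (mat 1 - \<mu> l *\<^sub>R R l) = mat 1 - \<mu> l *\<^sub>R conj_transpose (R l)"
    by (simp add: vec_eq_iff conj_transpose_def map_matrix_def transpose_def mat_def)
  then have "hermitian (mat 1 - \<mu> l *\<^sub>R R l)"
    using assms(3) by (simp add: hermitian_def pos_def_def)
  then show ?thesis
    unfolding composite_variance_def using assms
    by (intro add_pos_nonneg mult_pos_pos mult_nonneg_nonneg hermitian_trace_square_nonneg
        pos_def_trace_pos) auto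
qed

subsection \<open>Completing the square\<close>

text \<open>The constraint \<open>sum x S = 1\<close> turns the cross terms into the constant
  \<open>- 2 * c\<close>. Hence \<open>c\<close> is the minimum, attained where every
  \<open>x l\<close> is \<open>inverse (g l) * c\<close>.\<close>

lemma sum_squares_completion:
  fixes g x :: "'a \<Rightarrow> real"
  assumes "finite S" "S \<noteq> {}" "\<And>j. j \<in> S \<Longrightarrow> 0 < g j" "sum x S = 1"
  defines "c \<equiv> inverse (\<Sum>j\<in>S. inverse (g j))"
  shows "(\<Sum>l\<in>S. g l * (x l)\<^sup>2) = (\<Sum>l\<in>S. g l * (x l - inverse (g l) * c)\<^sup>2) + c"
proof -
  have pos: "0 < (\<Sum>j\<in>S. inverse (g j))"
    using assms(1-3) by (intro sum_pos) auto
  have "g l * (x l - inverse (g l) * c)\<^sup>2 = g l * (x l)\<^sup>2 - 2 * c * x l + c\<^sup>2 * inverse (g l)"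
    if "l \<in> S" for l
    using assms(3)[OF that] by (simp add: field_simps power2_eq_square)
  then have "(\<Sum>l\<in>S. g l * (x l - inverse (g l) * c)\<^sup>2) =
      (\<Sum>l\<in>S. g l * (x l)\<^sup>2) - 2 * c * sum x S + c\<^sup>2 * (\<Sum>l\<in>S. inverse (g l))"
    by (simp add: sum.distrib sum_subtractf sum_distrib_left)
  also have "c\<^sup>2 * (\<Sum>l\<in>S. inverse (g l)) = c"
    using pos by (simp add: c_def power2_eq_square)
  finally show ?thesis
    using assms(4) by simp
qed

lemma feasible_weights_iff:
  "feasible_weights Nb A \<longleftrightarrow> (\<forall>l k. 0 \<le> A $ l $ k) \<and> (\<forall>k. (\<Sum>l\<in>Nb k. A $ l $ k) = 1)
    \<and> (\<forall>l k. l \<notin> Nb k \<longrightarrow> A $ l $ k = 0)"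
proof -
  have "(\<Sum>l\<in>UNIV. A $ l $ k) = (\<Sum>l\<in>Nb k. A $ l $ k)" if "\<forall>l k. l \<notin> Nb k \<longrightarrow> A $ l $ k = 0" for k
    using that by (intro sum.mono_neutral_right) auto
  then show ?thesis
    by (auto simp: feasible_weights_def vec_eq_iff matrix_vector_mult_def transpose_def)
qed

text \<open>On feasible matrices the objective \<open>J\<close> is a constant plus \<open>J\<close>
  of the displacement from \<open>Z\<close>, and \<open>J\<close> is nonnegative and vanishes only
  at 0. This gives minimality and uniqueness of \<open>Z\<close> together.\<close>

lemma inverse_weights_unique_arg_min:
  fixes g :: "'n::finite \<Rightarrow> real" and A :: "real ^ 'n ^ 'n"
  assumes g: "\<And>l. 0 < g l" and Nb: "\<And>k. Nb k \<noteq> {}"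
  shows "is_arg_min (\<lambda>A. \<Sum>k\<in>UNIV. \<Sum>l\<in>UNIV. g l * (A $ l $ k)\<^sup>2) (feasible_weights Nb) A \<longleftrightarrow>
    (\<forall>l k. A $ l $ k = (if l \<in> Nb k then inverse (g l) / (\<Sum>j\<in>Nb k. inverse (g j)) else 0))"
proof -
  define c where "c k = inverse (\<Sum>j\<in>Nb k. inverse (g j))" for k
  define Z :: "real ^ 'n ^ 'n" where "Z = (\<chi> l k. if l \<in> Nb k then inverse (g l) * c k else 0)"
  define J where "J A = (\<Sum>k\<in>UNIV. \<Sum>l\<in>UNIV. g l * (A $ l $ k)\<^sup>2)" for A :: "real ^ 'n ^ 'n"
  have pos: "0 < (\<Sum>j\<in>Nb k. inverse (g j))" for k
    using Nb g by (intro sum_pos) auto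
  have Z: "feasible_weights Nb Z"
    using g pos by (auto simp: feasible_weights_iff Z_def c_def less_imp_le simp flip: sum_distrib_right)
      (simp add: less_imp_neq[THEN not_sym])
  have J: "J B = J (B - Z) + (\<Sum>k\<in>UNIV. c k)" if B: "feasible_weights Nb B" for B
  proof -
    \<comment> \<open>Both \<open>B\<close> and \<open>B - Z\<close> vanish outside the neighbor
      sets, so the square can be completed in each column over \<open>Nb k\<close> alone.\<close>
    have supp: "(\<Sum>l\<in>UNIV. g l * (C $ l $ k)\<^sup>2) = (\<Sum>l\<in>Nb k. g l * (C $ l $ k)\<^sup>2)"
      if "\<And>l. l \<notin> Nb k \<Longrightarrow> C $ l $ k = 0" for k and C :: "real ^ 'n ^ 'n"
      using that by (intro sum.mono_neutral_right) auto
    have "(\<Sum>l\<in>UNIV. g l * (B $ l $ k)\<^sup>2) = (\<Sum>l\<in>UNIV. g l * ((B - Z) $ l $ k)\<^sup>2) + c k" for k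
      using B Z sum_squares_completion[of "Nb k" g "\<lambda>l. B $ l $ k"] g Nb[of k]
      by (subst (1 2) supp) (auto simp: feasible_weights_iff Z_def c_def)
    then show ?thesis
      by (simp add: J_def sum.distrib)
  qed
  have J_nonneg: "0 \<le> J C" for C
    unfolding J_def using g by (intro sum_nonneg mult_nonneg_nonneg) (auto simp: less_imp_le)
  have J_zero: "C = 0" if "J C \<le> 0" for C
  proof -
    have "J C = 0"
      using that J_nonneg[of C] by simp
    then show ?thesis
      using g by (simp add: J_def sum_nonneg_eq_0_iff sum_nonneg less_imp_le vec_eq_iff
          less_imp_neq[THEN not_sym])
  qed
  have J0: "J 0 = 0"
    by (simp add: J_def)
  have "is_arg_min J (feasible_weights Nb) A \<longleftrightarrow> A = Z"
  proof
    assume "is_arg_min J (feasible_weights Nb) A"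
    then have "feasible_weights Nb A" "J A \<le> J Z"
      using Z by (auto simp: is_arg_min_def not_less)
    \<comment> \<open>\<open>J A\<close> and \<open>J Z\<close> exceed the same constant by
      \<open>J (A - Z)\<close> and by \<open>J 0 = 0\<close>.\<close>
    then have "J (A - Z) \<le> 0"
      using J[of A] J[OF Z] J0 by simp
    then show "A = Z"
      using J_zero by fastforce
  next
    assume "A = Z"
    moreover have "J Z \<le> J B" if "feasible_weights Nb B" for B
      using J[OF that] J[OF Z] J0 J_nonneg[of "B - Z"] by simp
    ultimately show "is_arg_min J (feasible_weights Nb) A"
      using Z by (auto simp: is_arg_min_def not_less)
  qed
  also have "A = Z \<longleftrightarrow> (\<forall>l k. A $ l $ k =
      (if l \<in> Nb k then inverse (g l) / (\<Sum>j\<in>Nb k. inverse (g j)) else 0))"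
    by (simp add: vec_eq_iff Z_def c_def divide_inverse)
  finally show ?thesis
    by (simp add: J_def[abs_def])
qed

text \<open>The equivalence says that the stated weights form a minimiser and that there is no
  other. \<open>composite_variance\<close> is already the squared quantity, so its plain inverse is
  the weight of exponent -2.\<close>

theorem theorem1:
  fixes E :: "('n::finite \<times> 'n) set"
    and \<mu> \<sigma> :: "'n \<Rightarrow> real"
    and R :: "'n \<Rightarrow> complex ^ 'm::finite ^ 'm"
    and Nb :: "'n \<Rightarrow> 'n set"
    and \<beta>\<^sub>o \<alpha>\<^sub>o :: real
    and A :: "real ^ 'n ^ 'n"
  assumes "\<And>k. 0 < \<mu> k"
    and "\<And>k. 0 < (\<sigma> k)\<^sup>2"
    and "\<And>k. pos_def (R k)"
    and "invertible (mat 1 - step_matrix \<mu> ** cov_matrix R)"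
    and "\<And>k. Nb k \<subseteq> multihop_nbhd E k"
    and "\<And>k. Nb k \<noteq> {}"
    and "is_arg_min (\<lambda>\<beta>. \<beta>) (\<lambda>\<beta>. pos_semidef (sdp_matrix \<mu> \<sigma> R \<beta>)) \<beta>\<^sub>o"
    and "\<alpha>\<^sub>o = inverse (\<beta>\<^sub>o + 1)"
  shows "is_arg_min (weight_cost \<mu> \<sigma> R \<alpha>\<^sub>o) (feasible_weights Nb) A \<longleftrightarrow>
    (\<forall>l k. A $ l $ k =
       (if l \<in> Nb k
        then inverse (composite_variance \<mu> \<sigma> R \<alpha>\<^sub>o l)
             / (\<Sum>j\<in>Nb k. inverse (composite_variance \<mu> \<sigma> R \<alpha>\<^sub>o j))
        else 0))"
proof -
  have "0 < \<beta>\<^sub>o"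
    using assms(1-3,7) sdp_feasible_pos[of \<mu> \<sigma> R \<beta>\<^sub>o] by (simp add: is_arg_min_def)
  then have "0 < \<alpha>\<^sub>o" "\<alpha>\<^sub>o \<le> 1"
    by (auto simp: assms(8) inverse_le_1_iff)
  then have "0 < composite_variance \<mu> \<sigma> R \<alpha>\<^sub>o l" for l
    using assms(1-3) by (intro composite_variance_pos)
  moreover have "weight_cost \<mu> \<sigma> R \<alpha>\<^sub>o =
      (\<lambda>A. \<Sum>k\<in>UNIV. \<Sum>l\<in>UNIV. composite_variance \<mu> \<sigma> R \<alpha>\<^sub>o l * (A $ l $ k)\<^sup>2)"
    using weight_cost_eq[of R] assms(3) by fast
  ultimately show ?thesis
    using inverse_weights_unique_arg_min[of "composite_variance \<mu> \<sigma> R \<alpha>\<^sub>o" Nb A] assms(6)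
    by simp
qed

end
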